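(* Let $n\ge1$ and $0\le c\le n$. Let $x_1,\dots,x_n$ be pairwise distinct complex numbers, put $s_i=e_i(x_1,\dots,x_n)$ for $0\le i\le n$ and $s_i=0$ otherwise, and let $D^k_c$ be the $k\times k$ matrix with entries $(D_c^k)_{ij}=s_{j-i+c}$, $1\le i,j\le k$ (i.e. the leading $k\times k$ submatrix of $(s_{j-i})_{i,j\ge1}$ after deleting its first $c$ columns). Then for every $k\ge1$, $$\det D^k_c=\sum_{\tau\subseteq[n],\ |\tau|=c}\ \prod_{i\in\tau}x_i^k\prod_{i\in\tau,\ j\notin\tau}\frac{x_i}{x_i-x_j}.$$
   Context: $e_i$ denotes the $i$-th elementary symmetric polynomial; $[n]=\{1,\dots,n\}$. The $x_i$ are the zeros of $\chi(t)=\prod_{i=1}^n(t-x_i)$. *)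

theory Defs
  imports Complex_Main "Jordan_Normal_Form.Determinant"
begin

text \<open>Variables are given as a sequence \<open>x\<close>, of which only \<open>x 1, \<dots>, x n\<close> are used.\<close>

definition elem_sym :: "nat \<Rightarrow> (nat \<Rightarrow> 'a::comm_ring_1) \<Rightarrow> nat \<Rightarrow> 'a" where
  "elem_sym n x i = (\<Sum>S\<in>{S. S \<subseteq> {1..n} \<and> card S = i}. \<Prod>j\<in>S. x j)"

definition s_coeff :: "nat \<Rightarrow> (nat \<Rightarrow> 'a::comm_ring_1) \<Rightarrow> int \<Rightarrow> 'a" where
  "s_coeff n x i = (if 0 \<le> i \<and> i \<le> int n then elem_sym n x (nat i) else 0)"

text \<open>Matrix indices of \<^const>\<open>mat\<close> start at 0, whereas \<open>i\<close> and \<open>j\<close> run from 1 to \<open>k\<close> in the usual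
  notation; the entry only depends on \<open>j - i\<close>, so the shift is immaterial.\<close>

definition D_mat :: "nat \<Rightarrow> (nat \<Rightarrow> 'a::comm_ring_1) \<Rightarrow> nat \<Rightarrow> nat \<Rightarrow> 'a mat" where
  "D_mat n x c k = mat k k (\<lambda>(i, j). s_coeff n x (int j - int i + int c))"

end

theory Submission
  imports Defs
begin

text \<open>Completing the banded Toeplitz matrix \<open>(s\<^bsub>j-i\<^esub>)\<close> to a square matrix and multiplying it by the
  powers of the zeros of \<open>\<chi>\<close>, which it annihilates, writes \<open>det D\<close> up to sign as the quotient of a
  generalised alternant, with \<open>c\<close> rows shifted by \<open>k\<close>, by the Vandermonde determinant. Grouping the
  Leibniz expansion of the alternant by the set \<open>\<tau>\<close> of columns that its shifted rows select pulls
  out the factor \<open>\<Prod>\<^bsub>i\<in>\<tau>\<^esub> x\<^sub>i\<^sup>k\<close>. What remains of the \<open>\<tau>\<close> part is compared with the Vandermonde matrix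
  itself: replacing its first \<open>c\<close> rows by multiples of \<open>\<Prod>\<^bsub>j\<notin>\<tau>\<^esub> (t - x\<^sub>j)\<close> does not change the
  determinant, but makes it block triangular.\<close>

section \<open>Laplace expansion along the first \<open>c\<close> rows\<close>

text \<open>For \<open>card \<tau> = c\<close> this is a block diagonal matrix up to the order of
  its columns. Leaving the columns in place avoids enumerating \<open>\<tau>\<close> and tracking
  the Laplace sign.\<close>

definition column_split_mat :: "nat \<Rightarrow> nat \<Rightarrow> nat set \<Rightarrow> 'a::zero mat \<Rightarrow> 'a mat" where
  "column_split_mat n c \<tau> A = mat n n (\<lambda>(i, l). if i < c \<longleftrightarrow> l \<in> \<tau> then A $$ (i, l) else 0)"

lemma column_split_mat_carrier [simp]: "column_split_mat n c \<tau> A \<in> carrier_mat n n"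
  by (simp add: column_split_mat_def)

lemma permutes_image_lessThan_eq:
  fixes n c :: nat
  assumes p: "p permutes {0..<n}" and "c \<le> n" and "card \<tau> = c" and fin: "finite \<tau>"
    and sub: "\<And>i. i < c \<Longrightarrow> p i \<in> \<tau>"
  shows "\<tau> = p ` {0..<c}"
proof -
  have "card (p ` {0..<c}) = c"
    using card_image[OF inj_on_subset[OF permutes_inj[OF p] subset_UNIV]] by simp
  moreover have "p ` {0..<c} \<subseteq> \<tau>" using sub by auto
  ultimately show ?thesis using card_subset_eq[OF fin] assms(3) by metis
qed

text \<open>A nonzero Leibniz term must send the first \<open>c\<close> rows into
  \<open>\<tau>\<close>, hence onto it by counting. Injectivity then sends the other rows outside
  \<open>\<tau>\<close>, so no factor has been altered.\<close>

lemma prod_column_split_mat: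
  assumes p: "p permutes {0..<n}" and "c \<le> n" and "\<tau> \<subseteq> {0..<n}" and "card \<tau> = c"
  shows "(\<Prod>i=0..<n. column_split_mat n c \<tau> A $$ (i, p i)) =
    (if \<tau> = p ` {0..<c} then \<Prod>i=0..<n. (A :: 'a::comm_ring_1 mat) $$ (i, p i) else 0)"
proof (cases "\<tau> = p ` {0..<c}")
  case True
  have iff: "i < c \<longleftrightarrow> p i \<in> \<tau>" for i
    unfolding True using inj_image_mem_iff[OF permutes_inj[OF p], of i "{0..<c}"] by simp
  have "column_split_mat n c \<tau> A $$ (i, p i) = A $$ (i, p i)" if "i < n" for i
    using that permutes_in_image[OF p, of i] by (simp add: column_split_mat_def iff)
  then show ?thesis unfolding if_P[OF True] by (intro prod.cong) simp_all
next
  case False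
  then obtain i where i: "i < c" "p i \<notin> \<tau>"
    using permutes_image_lessThan_eq[OF p \<open>c \<le> n\<close> \<open>card \<tau> = c\<close>] assms(3) finite_subset by blast
  have "column_split_mat n c \<tau> A $$ (i, p i) = 0"
    using i \<open>c \<le> n\<close> permutes_in_image[OF p, of i] by (simp add: column_split_mat_def)
  then have "(\<Prod>i=0..<n. column_split_mat n c \<tau> A $$ (i, p i)) = 0"
    using i \<open>c \<le> n\<close> by (intro prod_zero) auto
  then show ?thesis using False by simp
qed

text \<open>Each permutation survives for exactly one \<open>\<tau>\<close>, the image of the first
  \<open>c\<close> rows.\<close>

lemma det_sum_column_split_mat:
  fixes A :: "'a::comm_ring_1 mat"
  assumes A: "A \<in> carrier_mat n n" and c: "c \<le> n"
  shows "det A = (\<Sum>\<tau>\<in>{\<tau>. \<tau> \<subseteq> {0..<n} \<and> card \<tau> = c}. det (column_split_mat n c \<tau> A))"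
proof -
  let ?T = "{\<tau>. \<tau> \<subseteq> {0..<n} \<and> card \<tau> = c}"
  let ?f = "\<lambda>p. \<Prod>i=0..<n. A $$ (i, p i)"
  have fin: "finite ?T" by (rule finite_subset[of _ "Pow {0..<n}"]) auto
  have "(\<Sum>\<tau>\<in>?T. det (column_split_mat n c \<tau> A)) =
      (\<Sum>\<tau>\<in>?T. \<Sum>p | p permutes {0..<n}.
        signof p * (if \<tau> = p ` {0..<c} then ?f p else 0))"
    by (intro sum.cong refl)
      (auto simp: det_def'[of _ n] prod_column_split_mat[OF _ c] intro!: sum.cong)
  also have "\<dots> = (\<Sum>p | p permutes {0..<n}. \<Sum>\<tau>\<in>?T.
        if \<tau> = p ` {0..<c} then signof p * ?f p else 0)"
    by (subst sum.swap, intro sum.cong refl) auto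
  also have "\<dots> = (\<Sum>p | p permutes {0..<n}. signof p * ?f p)"
  proof (intro sum.cong refl)
    fix p :: "nat \<Rightarrow> nat" assume "p \<in> {p. p permutes {0..<n}}"
    then have p: "p permutes {0..<n}" by simp
    have "card (p ` {0..<c}) = c"
      using card_image[OF inj_on_subset[OF permutes_inj[OF p] subset_UNIV]] by simp
    moreover have "p ` {0..<c} \<subseteq> {0..<n}" using permutes_image[OF p] c by force
    ultimately show "(\<Sum>\<tau>\<in>?T. if \<tau> = p ` {0..<c} then signof p * ?f p else 0) = signof p * ?f p"
      using fin by (simp add: sum.delta)
  qed
  finally show ?thesis by (simp add: det_def'[OF A])
qed

text \<open>If the first \<open>c\<close> rows already vanish outside \<open>\<tau>\<close>, every
  Leibniz term of \<open>A\<close> belonging to another column set contains a zero factor. The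
  entries of the lower rows in the columns \<open>\<tau>\<close> may therefore be cleared
  too.\<close>

lemma det_eq_det_column_split_mat:
  fixes A :: "'a::comm_ring_1 mat"
  assumes A: "A \<in> carrier_mat n n" and c: "c \<le> n" and \<tau>: "\<tau> \<subseteq> {0..<n}" "card \<tau> = c"
    and zero: "\<And>i l. i < c \<Longrightarrow> l < n \<Longrightarrow> l \<notin> \<tau> \<Longrightarrow> A $$ (i, l) = 0"
  shows "det A = det (column_split_mat n c \<tau> A)"
proof -
  have "(\<Prod>i=0..<n. A $$ (i, p i)) = (\<Prod>i=0..<n. column_split_mat n c \<tau> A $$ (i, p i))"
    if p: "p permutes {0..<n}" for p
  proof (cases "\<tau> = p ` {0..<c}")
    case False
    then obtain i where i: "i < c" "p i \<notin> \<tau>"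
      using permutes_image_lessThan_eq[OF p c \<open>card \<tau> = c\<close>] \<tau>(1) finite_subset by blast
    moreover have "p i < n" using i(1) c permutes_in_image[OF p, of i] by simp
    ultimately have "A $$ (i, p i) = 0" using zero by blast
    then have "(\<Prod>i=0..<n. A $$ (i, p i)) = 0"
      using i c by (intro prod_zero) auto
    then show ?thesis using False prod_column_split_mat[OF p c \<tau>] by simp
  next
    case True
    show ?thesis unfolding prod_column_split_mat[OF p c \<tau>] if_P[OF True] ..
  qed
  then show ?thesis
    by (simp add: det_def'[OF A] det_def'[OF column_split_mat_carrier])
qed

lemma det_scale_cols:
  fixes f :: "nat \<Rightarrow> 'a::comm_ring_1"
  shows "det (mat n n (\<lambda>(i, l). f l * g i l)) = (\<Prod>l=0..<n. f l) * det (mat n n (\<lambda>(i, l). g i l))"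
proof -
  have "(\<Prod>i=0..<n. mat n n (\<lambda>(i, l). f l * g i l) $$ (i, p i)) =
      (\<Prod>l=0..<n. f l) * (\<Prod>i=0..<n. mat n n (\<lambda>(i, l). g i l) $$ (i, p i))"
    if p: "p permutes {0..<n}" for p
    using permutes_in_image[OF p] prod.permute[OF p, of f]
    by (simp add: prod.distrib o_def)
  then show ?thesis
    by (subst (1 2) det_def'[where n = n]) (auto simp: sum_distrib_left mult_ac intro!: sum.cong)
qed

section \<open>Alternants and the Vandermonde determinant\<close>

text \<open>The determinant is the numerator in the bialternant formula for the Schur polynomial of
  the rectangle with \<open>c\<close> rows of length \<open>k\<close>.\<close>

definition alternant_mat :: "nat \<Rightarrow> nat \<Rightarrow> nat \<Rightarrow> (nat \<Rightarrow> 'a::comm_ring_1) \<Rightarrow> 'a mat" where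
  "alternant_mat n c k y =
    mat n n (\<lambda>(i, l). (if i < c then y l ^ k else 1) * y l ^ (n - 1 - i))"

abbreviation vandermonde_mat :: "nat \<Rightarrow> (nat \<Rightarrow> 'a::comm_ring_1) \<Rightarrow> 'a mat" where
  "vandermonde_mat n y \<equiv> mat n n (\<lambda>(i, l). y l ^ (n - 1 - i))"

text \<open>A kernel vector of the transpose would list the coefficients of a nonzero polynomial of
  degree below \<open>n\<close> with \<open>n\<close> distinct roots.\<close>

lemma det_vandermonde_mat_nonzero:
  fixes y :: "nat \<Rightarrow> 'a::idom"
  assumes inj: "inj_on y {0..<n}"
  shows "det (vandermonde_mat n y) \<noteq> 0"
proof
  let ?V = "vandermonde_mat n y"
  assume "det ?V = 0"
  then have "det (transpose_mat ?V) = 0" by (simp add: det_transpose[of _ n])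
  then obtain v where v: "v \<in> carrier_vec n" "v \<noteq> 0\<^sub>v n" and
    ker: "transpose_mat ?V *\<^sub>v v = 0\<^sub>v n"
    using det_0_iff_vec_prod_zero[of "transpose_mat ?V" n] by auto
  define p where "p = (\<Sum>i<n. monom (v $ i) (n - 1 - i))"
  have coeff_p: "coeff p (n - 1 - i) = v $ i" if "i < n" for i
  proof -
    have "coeff p (n - 1 - i) = (\<Sum>j<n. if j = i then v $ i else 0)"
      unfolding p_def coeff_sum using that by (intro sum.cong) (auto simp: coeff_monom)
    then show ?thesis using that by simp
  qed
  have root: "poly p (y l) = 0" if "l < n" for l
  proof -
    have "poly p (y l) = (transpose_mat ?V *\<^sub>v v) $ l"
      using that v(1) unfolding p_def
      by (auto simp: poly_sum poly_monom scalar_prod_def mult_ac atLeast0LessThan intro!: sum.cong)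
    then show ?thesis unfolding ker using that by simp
  qed
  have "p \<noteq> 0"
  proof
    assume "p = 0"
    then have "v $ i = 0" if "i < n" for i using coeff_p[OF that] by simp
    then have "v = 0\<^sub>v n" using v(1) by (intro eq_vecI) auto
    then show False using v(2) by simp
  qed
  \<comment> \<open>For \<open>n = 0\<close> the truncated bound \<open>n - 1\<close> would be
    \<open>0\<close> and would not contradict the root count.\<close>
  have "n \<noteq> 0" using v by (cases n) auto
  have "degree p \<le> n - 1"
    unfolding p_def by (intro degree_sum_le) (auto intro: order.trans[OF degree_monom_le])
  have "n = card (y ` {0..<n})" using card_image[OF inj] by simp
  also have "\<dots> \<le> card {t. poly p t = 0}"
    using root poly_roots_finite[OF \<open>p \<noteq> 0\<close>] by (intro card_mono) auto
  also have "\<dots> \<le> degree p" using card_poly_roots_bound[OF \<open>p \<noteq> 0\<close>] .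
  finally show False using \<open>degree p \<le> n - 1\<close> \<open>n \<noteq> 0\<close> by simp
qed

lemma poly_eq_sum_reverse:
  fixes p :: "'a::comm_semiring_1 poly"
  assumes "degree p < n"
  shows "(\<Sum>b<n. coeff p (n - 1 - b) * t ^ (n - 1 - b)) = poly p t"
proof -
  have "poly p t = (\<Sum>b<n. coeff p b * t ^ b)"
    unfolding poly_altdef using assms
    by (intro sum.mono_neutral_left) (auto simp: coeff_eq_0)
  also have "\<dots> = (\<Sum>b<n. coeff p (n - 1 - b) * t ^ (n - 1 - b))"
    by (subst sum.nat_diff_reindex[symmetric]) simp
  finally show ?thesis by simp
qed

text \<open>In the monomials of decreasing degree, the coefficient matrix of the \<open>q i\<close>
  is upper triangular with unit diagonal, so this row operation has determinant 1.\<close>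

lemma det_vandermonde_reduce:
  fixes y :: "nat \<Rightarrow> 'a::comm_ring_1"
  assumes q: "\<And>i. i < n \<Longrightarrow> degree (q i) \<le> n - 1 - i" "\<And>i. i < n \<Longrightarrow> coeff (q i) (n - 1 - i) = 1"
  shows "det (mat n n (\<lambda>(i, l). poly (q i) (y l))) = det (vandermonde_mat n y)"
proof -
  define L where "L = mat n n (\<lambda>(i, b). coeff (q i) (n - 1 - b))"
  have "mat n n (\<lambda>(i, l). poly (q i) (y l)) = L * vandermonde_mat n y"
  proof (rule eq_matI)
    fix i l assume "i < dim_row (L * vandermonde_mat n y)" "l < dim_col (L * vandermonde_mat n y)"
    then have il: "i < n" "l < n" by (auto simp: L_def)
    have "degree (q i) < n" using q(1)[OF il(1)] il by linarith
    from poly_eq_sum_reverse[OF this] il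
    show "mat n n (\<lambda>(i, l). poly (q i) (y l)) $$ (i, l) = (L * vandermonde_mat n y) $$ (i, l)"
      by (auto simp: L_def scalar_prod_def atLeast0LessThan)
  qed (auto simp: L_def)
  moreover have "upper_triangular L"
    unfolding upper_triangular_def L_def
  proof (intro allI impI)
    fix i j assume "i < dim_row (mat n n (\<lambda>(i, b). coeff (q i) (n - 1 - b)))" "j < i"
    then have "i < n" "j < i" by auto
    moreover from this have "degree (q i) < n - 1 - j" using q(1)[of i] by linarith
    ultimately show "mat n n (\<lambda>(i, b). coeff (q i) (n - 1 - b)) $$ (i, j) = 0"
      by (simp add: coeff_eq_0)
  qed
  then have "det L = 1"
    by (subst det_upper_triangular[of _ n]) (use q(2) in \<open>auto simp: L_def prod_list_diag_prod intro!: prod.neutral\<close>)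
  moreover have "L \<in> carrier_mat n n" by (simp add: L_def)
  ultimately show ?thesis
    by (simp only: det_mult[of L n "vandermonde_mat n y"] mat_carrier mult_1)
qed

text \<open>Both determinants are column scalings of the same split matrix \<open>?G\<close>, built
  from Vandermonde blocks on \<open>\<tau>\<close> and on its complement. The form without division
  holds in any commutative ring.\<close>

lemma det_column_split_vandermonde:
  fixes y :: "nat \<Rightarrow> 'a::comm_ring_1"
  assumes c: "c \<le> n" and \<tau>: "\<tau> \<subseteq> {0..<n}" "card \<tau> = c"
  shows "det (column_split_mat n c \<tau> (vandermonde_mat n y)) * (\<Prod>i\<in>\<tau>. \<Prod>j\<in>{0..<n} - \<tau>. y i - y j) =
    det (vandermonde_mat n y) * (\<Prod>i\<in>\<tau>. y i ^ (n - c))"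
proof -
  let ?C = "{0..<n} - \<tau>"
  have fin: "finite \<tau>" using \<tau>(1) finite_subset by blast
  have card_C: "card ?C = n - c" using card_Diff_subset[OF fin \<tau>(1)] \<tau>(2) by simp
  have prod_\<tau>: "(\<Prod>l=0..<n. if l \<in> \<tau> then a l else 1) = (\<Prod>l\<in>\<tau>. a l)" for a :: "nat \<Rightarrow> 'a"
    using \<tau>(1) by (intro prod.mono_neutral_cong_right) auto
  define P where "P = (\<Prod>j\<in>?C. [:- y j, 1:])"
  have poly_P: "poly P t = (\<Prod>j\<in>?C. t - y j)" for t
    by (simp add: P_def poly_prod)
  have "degree P \<le> n - c"
    using degree_prod_sum_le[of ?C "\<lambda>j. [:- y j, 1:]"] card_C by (simp add: P_def o_def)
  moreover have "coeff P (n - c) = 1"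
  proof -
    \<comment> \<open>Degrees need not add over a ring with zero divisors, so the induction carries
      the degree bound together with the leading coefficient.\<close>
    have "coeff (\<Prod>j\<in>C. [:- y j, 1:]) (card C) = 1 \<and> degree (\<Prod>j\<in>C. [:- y j, 1:]) \<le> card C"
      if "finite C" for C
      using that
    proof induction
      case (insert j C)
      let ?Q = "\<Prod>j\<in>C. [:- y j, 1:]"
      have "coeff ?Q (Suc (card C)) = 0" using insert by (intro coeff_eq_0) simp
      moreover have "degree ([:- y j, 1:] * ?Q) \<le> Suc (card C)"
        using insert degree_mult_le[of "[:- y j, 1:]" ?Q] by simp
      ultimately show ?case using insert by simp
    qed simp
    from this[of ?C] show ?thesis by (simp add: P_def card_C)
  qed
  ultimately have P: "degree P \<le> n - c" "coeff P (n - c) = 1" .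
  \<comment> \<open>The monomial factor raises the degree \<open>n - c\<close> of \<open>P\<close>
    to \<open>n - 1 - i\<close>, keeping \<open>q i\<close> monic as the reduction requires.\<close>
  define q where "q i = (if i < c then monom 1 (c - 1 - i) * P else monom 1 (n - 1 - i))" for i
  let ?Q = "mat n n (\<lambda>(i, l). poly (q i) (y l))"
  \<comment> \<open>The exponents count down to 0 in each block separately, hence \<open>c\<close>
    for the upper rows and \<open>n\<close> for the lower ones.\<close>
  define g where "g i l = (if i < c \<longleftrightarrow> l \<in> \<tau> then y l ^ ((if i < c then c else n) - 1 - i) else 0)" for i l
  let ?G = "mat n n (\<lambda>(i, l). g i l)"
  have "det (vandermonde_mat n y) = det ?Q"
  proof (rule det_vandermonde_reduce[symmetric])
    fix i assume i: "i < n"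
    have split: "n - Suc i = (c - Suc i) + (n - c)" if "i < c" using that c by linarith
    have "degree (monom 1 (c - 1 - i) * P) \<le> (c - 1 - i) + (n - c)"
      by (rule order.trans[OF degree_mult_le add_mono[OF degree_monom_le P(1)]])
    then show "degree (q i) \<le> n - 1 - i"
      using split by (auto simp: q_def degree_monom_le)
    show "coeff (q i) (n - 1 - i) = 1"
      using split P(2) by (auto simp: q_def coeff_monom_mult)
  qed
  also have "\<dots> = det (column_split_mat n c \<tau> ?Q)"
  proof (rule det_eq_det_column_split_mat[OF _ c \<tau>])
    fix i l assume "i < c" "l < n" "l \<notin> \<tau>"
    then have "poly P (y l) = 0" unfolding poly_P by (intro prod_zero) auto
    then show "?Q $$ (i, l) = 0" using \<open>i < c\<close> \<open>l < n\<close> c by (simp add: q_def)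
  qed simp
  also have "column_split_mat n c \<tau> ?Q = mat n n (\<lambda>(i, l). (if l \<in> \<tau> then poly P (y l) else 1) * g i l)"
    by (rule eq_matI) (auto simp: column_split_mat_def g_def q_def poly_monom)
  also have "det \<dots> = (\<Prod>l\<in>\<tau>. poly P (y l)) * det ?G"
    by (simp add: det_scale_cols prod_\<tau>)
  finally have V: "det (vandermonde_mat n y) = (\<Prod>l\<in>\<tau>. poly P (y l)) * det ?G" .
  \<comment> \<open>The surplus exponent \<open>n - c\<close> does not depend on the row, so it
    leaves the determinant as a column factor.\<close>
  have "y l ^ (n - Suc i) = y l ^ (n - c) * y l ^ (c - Suc i)" if "i < c" for i l
    using that c by (simp flip: power_add)
  then have "column_split_mat n c \<tau> (vandermonde_mat n y) =
      mat n n (\<lambda>(i, l). (if l \<in> \<tau> then y l ^ (n - c) else 1) * g i l)"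
    by (intro eq_matI) (auto simp: column_split_mat_def g_def)
  then have "det (column_split_mat n c \<tau> (vandermonde_mat n y)) = (\<Prod>l\<in>\<tau>. y l ^ (n - c)) * det ?G"
    by (simp add: det_scale_cols prod_\<tau>)
  then show ?thesis by (simp only: V poly_P mult_ac)
qed

text \<open>After splitting, the columns in \<open>\<tau>\<close> contain only shifted rows and the
  others only unshifted ones, so the shift becomes a column factor. Distinctness of the
  \<open>y i\<close> allows division by the differences.\<close>

lemma det_alternant_mat:
  fixes y :: "nat \<Rightarrow> 'a::field"
  assumes c: "c \<le> n" and inj: "inj_on y {0..<n}"
  shows "det (alternant_mat n c k y) = det (vandermonde_mat n y) *
    (\<Sum>\<tau>\<in>{\<tau>. \<tau> \<subseteq> {0..<n} \<and> card \<tau> = c}.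
      (\<Prod>i\<in>\<tau>. y i ^ k) * (\<Prod>i\<in>\<tau>. \<Prod>j\<in>{0..<n} - \<tau>. y i / (y i - y j)))"
proof -
  have "det (column_split_mat n c \<tau> (alternant_mat n c k y)) = det (vandermonde_mat n y) *
      ((\<Prod>i\<in>\<tau>. y i ^ k) * (\<Prod>i\<in>\<tau>. \<Prod>j\<in>{0..<n} - \<tau>. y i / (y i - y j)))"
    if \<tau>: "\<tau> \<subseteq> {0..<n}" "card \<tau> = c" for \<tau>
  proof -
    let ?S = "column_split_mat n c \<tau> (vandermonde_mat n y)"
    let ?d = "\<Prod>i\<in>\<tau>. \<Prod>j\<in>{0..<n} - \<tau>. y i - y j"
    have fin: "finite \<tau>" using \<tau>(1) finite_subset by blast
    have "card ({0..<n} - \<tau>) = n - c" using card_Diff_subset[OF fin \<tau>(1)] \<tau>(2) by simp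
    then have "(\<Prod>i\<in>\<tau>. \<Prod>j\<in>{0..<n} - \<tau>. y i / (y i - y j)) = (\<Prod>i\<in>\<tau>. y i ^ (n - c)) / ?d"
      by (simp add: prod_dividef)
    moreover have "?d \<noteq> 0"
      using inj \<tau>(1) fin by (auto simp: inj_on_def)
    then have "det ?S = det (vandermonde_mat n y) * ((\<Prod>i\<in>\<tau>. y i ^ (n - c)) / ?d)"
      using det_column_split_vandermonde[OF c \<tau>, of y] by (simp add: field_simps)
    moreover have "column_split_mat n c \<tau> (alternant_mat n c k y) =
        mat n n (\<lambda>(i, l). (if l \<in> \<tau> then y l ^ k else 1) * ?S $$ (i, l))"
      by (rule eq_matI) (auto simp: column_split_mat_def alternant_mat_def)
    then have "det (column_split_mat n c \<tau> (alternant_mat n c k y)) =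
        (\<Prod>l=0..<n. if l \<in> \<tau> then y l ^ k else 1) * det (mat n n (\<lambda>(i, l). ?S $$ (i, l)))"
      by (simp add: det_scale_cols)
    moreover have "mat n n (\<lambda>(i, l). ?S $$ (i, l)) = ?S"
      by (rule eq_matI) (auto simp: column_split_mat_def)
    moreover have "(\<Prod>l=0..<n. if l \<in> \<tau> then y l ^ k else 1) = (\<Prod>l\<in>\<tau>. y l ^ k)"
      using \<tau>(1) by (intro prod.mono_neutral_cong_right) auto
    ultimately show ?thesis by simp
  qed
  then show ?thesis
    by (subst det_sum_column_split_mat[OF _ c]) (auto simp: alternant_mat_def sum_distrib_left)
qed

section \<open>The banded Toeplitz matrix and its minors\<close>

text \<open>Expanding the product groups the subsets of \<open>{1..n}\<close> by size. The product
  is \<open>\<chi>\<close> at \<open>- t\<close> up to the sign \<open>(-1) ^ n\<close>, which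
  avoids alternating signs on the left.\<close>

lemma sum_s_coeff_power:
  "(\<Sum>r\<le>n. s_coeff n x (int r) * t ^ (n - r)) = (\<Prod>j\<in>{1..n}. x j + t)"
proof -
  have "(\<Prod>j\<in>{1..n}. x j + t) = (\<Sum>S\<in>Pow {1..n}. (\<Prod>j\<in>S. x j) * t ^ card ({1..n} - S))"
    by (subst prod_add) simp_all
  also have "\<dots> = (\<Sum>r\<le>n. \<Sum>S\<in>{S \<in> Pow {1..n}. card S = r}. (\<Prod>j\<in>S. x j) * t ^ card ({1..n} - S))"
    by (rule sum.group[symmetric]) (auto dest: card_mono[rotated])
  also have "\<dots> = (\<Sum>r\<le>n. s_coeff n x (int r) * t ^ (n - r))"
    by (auto simp: s_coeff_def elem_sym_def sum_distrib_right card_Diff_subset finite_subset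
      intro!: sum.cong)
  finally show ?thesis by simp
qed

text \<open>The band of row \<open>i\<close> occupies the columns \<open>i\<close> to
  \<open>i + n\<close>, which \<open>i < k\<close> keeps inside the \<open>k + n\<close>
  columns.\<close>

lemma sum_shifted_s_coeff_power:
  assumes "i < k"
  shows "(\<Sum>m<k + n. s_coeff n x (int m - int i) * t ^ (k + n - 1 - m)) =
    t ^ (k - 1 - i) * (\<Prod>j\<in>{1..n}. x j + t)"
proof -
  have "(\<Sum>m<k + n. s_coeff n x (int m - int i) * t ^ (k + n - 1 - m)) =
      (\<Sum>m\<in>{i..i + n}. s_coeff n x (int m - int i) * t ^ (k + n - 1 - m))"
    using assms by (intro sum.mono_neutral_right) (auto simp: s_coeff_def)
  also have "\<dots> = (\<Sum>r\<le>n. s_coeff n x (int r) * t ^ (k + n - 1 - (i + r)))"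
    by (rule sum.reindex_bij_witness[of _ "\<lambda>r. i + r" "\<lambda>m. m - i"]) auto
  also have "\<dots> = (\<Sum>r\<le>n. t ^ (k - 1 - i) * (s_coeff n x (int r) * t ^ (n - r)))"
  proof (intro sum.cong refl)
    fix r assume "r \<in> {..n}"
    then have "k + n - 1 - (i + r) = (k - 1 - i) + (n - r)" using assms by auto
    then show "s_coeff n x (int r) * t ^ (k + n - 1 - (i + r)) =
        t ^ (k - 1 - i) * (s_coeff n x (int r) * t ^ (n - r))"
      by (simp add: power_add mult_ac)
  qed
  finally show ?thesis
    by (simp only: sum_s_coeff_power flip: sum_distrib_left)
qed

text \<open>Dual Jacobi--Trudi. The rows of \<open>A\<close> are the coefficient vectors of \<open>\<chi>\<close> times a monomial,
  which annihilate the power columns of \<open>B\<close>, completed by the unit rows that cut the columns of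
  \<^const>\<open>D_mat\<close> out of the banded matrix. Taking \<open>y = - x\<close> absorbs the signs of the coefficients
  of \<open>\<chi>\<close>.\<close>

lemma det_D_mat_vandermonde:
  fixes x :: "nat \<Rightarrow> 'a::idom"
  assumes c: "c \<le> n"
  defines "y \<equiv> \<lambda>l. - x (Suc l)"
  shows "det (D_mat n x c k) * det (vandermonde_mat n y) = (-1) ^ (k * c) * det (alternant_mat n c k y)"
proof -
  let ?N = "k + n"
  \<comment> \<open>The unit rows occupy the columns below \<open>c\<close> and from
    \<open>c + k\<close> on, leaving exactly the \<open>k\<close> columns of
    \<open>D_mat\<close>.\<close>
  define A where "A = mat ?N ?N (\<lambda>(i, m). if i < k then s_coeff n x (int m - int i)
    else if m = (if i < k + c then i - k else i) then 1 else 0)"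
  define E where "E = mat k n (\<lambda>(m, l). y l ^ (?N - 1 - m))"
  \<comment> \<open>The last \<open>n\<close> columns are full power columns of length
    \<open>?N\<close>; the identity block makes \<open>B\<close> square and leaves the Vandermonde
    determinant.\<close>
  define B where "B = four_block_mat (1\<^sub>m k) E (0\<^sub>m n k) (vandermonde_mat n y)"
  have A: "A \<in> carrier_mat ?N ?N" and B: "B \<in> carrier_mat ?N ?N"
    by (simp_all add: A_def B_def E_def)
  have det_B: "det B = det (vandermonde_mat n y)"
    unfolding B_def by (subst det_four_block_mat_lower_left_zero[of _ k _ n]) (simp_all add: E_def)
  have B_unit: "B $$ (m, j) = (if m = j then 1 else 0)" if "m < ?N" "j < k" for m j
    using that by (auto simp: B_def E_def)
  have B_power: "B $$ (m, j) = y (j - k) ^ (?N - 1 - m)" if "m < ?N" "k \<le> j" "j < ?N" for m j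
    using that by (auto simp: B_def E_def add.commute)
  have AB: "(A * B) $$ (i, j) = (\<Sum>m<?N. A $$ (i, m) * B $$ (m, j))" if "i < ?N" "j < ?N" for i j
    using that A B by (auto simp: scalar_prod_def atLeast0LessThan)

  let ?U = "mat k k (\<lambda>(i, j). s_coeff n x (int j - int i))"
  define C where "C = mat n k (\<lambda>(i, j). (A * B) $$ (k + i, j))"
  \<comment> \<open>The zero block is the annihilation of the power columns. Below it, the unit rows
    select the powers that form the alternant.\<close>
  have "A * B = four_block_mat ?U (0\<^sub>m k n) C (alternant_mat n c k y)"
  proof (rule eq_matI)
    fix i j
    assume "i < dim_row (four_block_mat ?U (0\<^sub>m k n) C (alternant_mat n c k y))"
      "j < dim_col (four_block_mat ?U (0\<^sub>m k n) C (alternant_mat n c k y))"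
    then have ij: "i < ?N" "j < ?N" by (auto simp: alternant_mat_def)
    consider "i < k" "j < k" | "i < k" "k \<le> j" | "k \<le> i" "j < k" | "k \<le> i" "k \<le> j" by linarith
    then show "(A * B) $$ (i, j) = four_block_mat ?U (0\<^sub>m k n) C (alternant_mat n c k y) $$ (i, j)"
    proof cases
      case 1
      have "(A * B) $$ (i, j) = (\<Sum>m<?N. if m = j then A $$ (i, m) else 0)"
        unfolding AB[OF ij] using 1 by (intro sum.cong) (auto simp: B_unit)
      then show ?thesis using ij 1 by (simp add: A_def alternant_mat_def)
    next
      case 2
      have "(A * B) $$ (i, j) = (\<Sum>m<?N. s_coeff n x (int m - int i) * y (j - k) ^ (?N - 1 - m))"
        unfolding AB[OF ij] using ij 2 by (intro sum.cong) (auto simp: B_power A_def)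
      also have "\<dots> = y (j - k) ^ (k - 1 - i) * (\<Prod>l\<in>{1..n}. x l + y (j - k))"
        using 2(1) by (rule sum_shifted_s_coeff_power)
      \<comment> \<open>The factor at \<open>l = Suc (j - k)\<close> is
        \<open>x l - x l\<close>.\<close>
      also have "(\<Prod>l\<in>{1..n}. x l + y (j - k)) = 0"
        using ij 2 by (intro prod_zero bexI[of _ "Suc (j - k)"]) (auto simp: y_def)
      finally show ?thesis using ij 2 by (simp add: alternant_mat_def)
    next
      case 3
      then show ?thesis using ij by (simp add: alternant_mat_def C_def)
    next
      case 4
      let ?r = "if i < k + c then i - k else i"
      have "?r < ?N" using ij by auto
      have "(A * B) $$ (i, j) = (\<Sum>m<?N. if m = ?r then B $$ (m, j) else 0)"
        unfolding AB[OF ij] using ij 4 by (intro sum.cong) (auto simp: A_def)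
      also have "\<dots> = B $$ (?r, j)" using \<open>?r < ?N\<close> by simp
      also have "\<dots> = y (j - k) ^ (?N - 1 - ?r)" using \<open>?r < ?N\<close> ij 4 by (intro B_power)
      \<comment> \<open>The first \<open>c\<close> unit rows pick a row of \<open>B\<close> lying
        \<open>k\<close> places higher, whose exponent is larger by \<open>k\<close>: this is the
        shift of the alternant.\<close>
      also have "?N - 1 - ?r = (if i < k + c then k else 0) + (n - 1 - (i - k))"
        using ij 4 c by auto
      also have "y (j - k) ^ \<dots> = (if i < k + c then y (j - k) ^ k else 1) * y (j - k) ^ (n - 1 - (i - k))"
        by (cases "i < k + c") (simp_all only: power_add power_0 if_True if_False)
      also have "\<dots> = four_block_mat ?U (0\<^sub>m k n) C (alternant_mat n c k y) $$ (i, j)"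
        using ij 4 by (auto simp: alternant_mat_def)
      finally show ?thesis .
    qed
  qed (use A B in \<open>auto simp: alternant_mat_def\<close>)
  moreover have "C \<in> carrier_mat n k" "alternant_mat n c k y \<in> carrier_mat n n"
    by (simp_all add: C_def alternant_mat_def)
  ultimately have "det (A * B) = det ?U * det (alternant_mat n c k y)"
    by (simp add: det_four_block_mat_upper_right_zero[of _ k _ n])
  moreover have "det ?U = 1"
  proof -
    have "upper_triangular ?U" by (auto simp: s_coeff_def)
    moreover have "elem_sym n x 0 = 1"
    proof -
      have "{S. S \<subseteq> {1..n} \<and> card S = 0} = {{}}" by (auto dest: finite_subset)
      then show ?thesis by (simp add: elem_sym_def)
    qed
    ultimately show ?thesis
      by (subst det_upper_triangular[of _ k]) (auto simp: prod_list_diag_prod s_coeff_def)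
  qed
  moreover have "det A = (-1) ^ (k * c) * det (D_mat n x c k)"
  proof -
    \<comment> \<open>Moving the \<open>c\<close> unit rows above the \<open>k\<close> Toeplitz rows
      takes \<open>k * c\<close> adjacent swaps and makes \<open>D_mat\<close> a diagonal
      block.\<close>
    define A' where "A' = mat ?N ?N (\<lambda>(i, j). A $$ (if i < c then i + k else if i < k + c then i - c else i, j))"
    define L where "L = mat (k + (n - c)) c (\<lambda>(i, j). A' $$ (c + i, j))"
    define R where "R = mat k (n - c) (\<lambda>(i, j). A' $$ (c + i, c + k + j))"
    let ?D' = "four_block_mat (D_mat n x c k) R (0\<^sub>m (n - c) k) (1\<^sub>m (n - c))"
    have "A' = four_block_mat (1\<^sub>m c) (0\<^sub>m c (k + (n - c))) L ?D'"
      using c by (intro eq_matI) (auto simp: L_def R_def A'_def A_def D_mat_def algebra_simps of_nat_diff)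
    moreover have "L \<in> carrier_mat (k + (n - c)) c" "?D' \<in> carrier_mat (k + (n - c)) (k + (n - c))"
      by (simp_all add: L_def D_mat_def)
    ultimately have "det A' = det (1\<^sub>m c) * det ?D'"
      by (simp add: det_four_block_mat_upper_right_zero[of _ c _ "k + (n - c)"])
    also have "\<dots> = det (D_mat n x c k)"
      by (subst det_four_block_mat_lower_left_zero[of _ k _ "n - c"]) (simp_all add: D_mat_def R_def)
    finally show ?thesis
      using det_swap_initial_rows[OF A, of k c] c by (simp add: A'_def)
  qed
  ultimately have "(-1) ^ (k * c) * (det (D_mat n x c k) * det (vandermonde_mat n y)) =
      det (alternant_mat n c k y)"
    using det_mult[OF A B] det_B by (simp only: mult.assoc mult_1)
  then have "(-1) ^ (k * c) * ((-1) ^ (k * c) * (det (D_mat n x c k) * det (vandermonde_mat n y))) =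
      (-1) ^ (k * c) * det (alternant_mat n c k y)"
    by simp
  then show ?thesis
    by (simp flip: mult.assoc power_mult_distrib)
qed

section \<open>The expansion over subsets of the zeros\<close>

theorem theorem4:
  fixes n c k :: nat and x :: "nat \<Rightarrow> complex"
  assumes "n \<ge> 1" and "c \<le> n" and "inj_on x {1..n}" and "k \<ge> 1"
  shows "det (D_mat n x c k) =
    (\<Sum>\<tau>\<in>{\<tau>. \<tau> \<subseteq> {1..n} \<and> card \<tau> = c}.
      (\<Prod>i\<in>\<tau>. x i ^ k) * (\<Prod>i\<in>\<tau>. \<Prod>j\<in>{1..n} - \<tau>. x i / (x i - x j)))"
proof -
  let ?y = "\<lambda>l. - x (Suc l)"
  let ?V = "vandermonde_mat n ?y"
  let ?T = "{\<tau>. \<tau> \<subseteq> {1..n} \<and> card \<tau> = c}"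
  let ?S = "{\<tau>. \<tau> \<subseteq> {0..<n} \<and> card \<tau> = c}"
  have inj: "inj_on ?y {0..<n}"
    using inj_onD[OF \<open>inj_on x {1..n}\<close>] by (intro inj_onI) fastforce
  have Suc_image: "Suc ` {0..<n} = {1..n}"
    by (simp add: image_Suc_atLeastLessThan atLeastLessThanSuc_atLeastAtMost)
  have "(\<Sum>\<tau>\<in>?T. (\<Prod>i\<in>\<tau>. x i ^ k) * (\<Prod>i\<in>\<tau>. \<Prod>j\<in>{1..n} - \<tau>. x i / (x i - x j))) =
      (\<Sum>\<tau>\<in>?S. (\<Prod>i\<in>Suc ` \<tau>. x i ^ k) *
        (\<Prod>i\<in>Suc ` \<tau>. \<Prod>j\<in>{1..n} - Suc ` \<tau>. x i / (x i - x j)))"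
  proof (rule sum.reindex_bij_betw[symmetric])
    have "?T = (`) Suc ` ?S"
    proof (intro equalityI subsetI)
      fix \<tau> assume \<tau>: "\<tau> \<in> ?T"
      then have "\<tau> \<subseteq> Suc ` {0..<n}" unfolding Suc_image by simp
      then obtain C where C: "C \<subseteq> {0..<n}" "\<tau> = Suc ` C" by (rule subset_imageE)
      moreover have "card C = c" using \<tau> C(2) by (simp add: card_image)
      ultimately show "\<tau> \<in> (`) Suc ` ?S" by blast
    next
      fix \<tau> assume "\<tau> \<in> (`) Suc ` ?S"
      then obtain C where C: "C \<subseteq> {0..<n}" "card C = c" "\<tau> = Suc ` C" by blast
      then have "\<tau> \<subseteq> {1..n}" unfolding Suc_image[symmetric] by (simp only: image_mono)
      then show "\<tau> \<in> ?T" using C by (simp add: card_image)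
    qed
    then show "bij_betw ((`) Suc) ?S ?T"
      by (simp add: bij_betw_def inj_on_def inj_image_eq_iff)
  qed
  \<comment> \<open>Negating all variables preserves the quotients, while each of the
    \<open>c\<close> powers contributes \<open>(-1) ^ k\<close>. The resulting sign matches the one
    from the row swaps.\<close>
  also have "\<dots> = (\<Sum>\<tau>\<in>?S. (-1) ^ (k * c) *
      ((\<Prod>i\<in>\<tau>. ?y i ^ k) * (\<Prod>i\<in>\<tau>. \<Prod>j\<in>{0..<n} - \<tau>. ?y i / (?y i - ?y j))))"
  proof (intro sum.cong refl)
    fix \<tau> assume "\<tau> \<in> ?S"
    then have "card \<tau> = c" by simp
    have "?y i / (?y i - ?y j) = x (Suc i) / (x (Suc i) - x (Suc j))" for i j
      using minus_divide_divide[of "x (Suc i)" "x (Suc i) - x (Suc j)"] by simp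
    then have "(\<Prod>i\<in>\<tau>. \<Prod>j\<in>{0..<n} - \<tau>. ?y i / (?y i - ?y j)) =
        (\<Prod>i\<in>Suc ` \<tau>. \<Prod>j\<in>{1..n} - Suc ` \<tau>. x i / (x i - x j))"
      unfolding Suc_image[symmetric] image_set_diff[OF inj_Suc, symmetric]
      by (simp add: prod.reindex)
    moreover have "(\<Prod>i\<in>Suc ` \<tau>. x i ^ k) = (\<Prod>i\<in>\<tau>. (-1) ^ k * ?y i ^ k)"
      by (simp add: prod.reindex flip: power_mult_distrib)
    then have "(\<Prod>i\<in>Suc ` \<tau>. x i ^ k) = (-1) ^ (k * c) * (\<Prod>i\<in>\<tau>. ?y i ^ k)"
      using \<open>card \<tau> = c\<close> by (simp only: prod.distrib prod_constant power_mult)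
    ultimately show "(\<Prod>i\<in>Suc ` \<tau>. x i ^ k) *
        (\<Prod>i\<in>Suc ` \<tau>. \<Prod>j\<in>{1..n} - Suc ` \<tau>. x i / (x i - x j)) = (-1) ^ (k * c) *
      ((\<Prod>i\<in>\<tau>. ?y i ^ k) * (\<Prod>i\<in>\<tau>. \<Prod>j\<in>{0..<n} - \<tau>. ?y i / (?y i - ?y j)))"
      by (simp only: mult.assoc)
  qed
  finally have "det ?V * (\<Sum>\<tau>\<in>?T. (\<Prod>i\<in>\<tau>. x i ^ k) *
      (\<Prod>i\<in>\<tau>. \<Prod>j\<in>{1..n} - \<tau>. x i / (x i - x j))) = (-1) ^ (k * c) * det (alternant_mat n c k ?y)"
    by (simp only: det_alternant_mat[OF \<open>c \<le> n\<close> inj] mult.left_commute flip: sum_distrib_left)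
  also have "\<dots> = det ?V * det (D_mat n x c k)"
    by (subst mult.commute[of "det ?V"]) (rule det_D_mat_vandermonde[OF \<open>c \<le> n\<close>, symmetric])
  finally show ?thesis
    \<comment> \<open>Distinctness of the zeros makes the Vandermonde determinant nonzero, so it
      cancels.\<close>
    unfolding mult_left_cancel[OF det_vandermonde_mat_nonzero[OF inj]] by (rule sym)
qed

end
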